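(* Let $N>0$, $\tau\in(0,1)$, and let $(v_1,v_2)$ be a radial solution of $(P)_\tau$ as described in the context, with flux pair $(\beta_1,\beta_2)$. Then: (i) If $\tau\in(0,\frac12)$, then $\beta_i\le\beta_i^*(\tau)$ for $i=1,2$, and $\beta_2=\varphi_1^+(\beta_1)\ge\max\{\beta_2^{**}(\tau),4\}$; equivalently, $\beta_1=\varphi_2^+(\beta_2)\ge\max\{\beta_1^{**}(\tau),4(N+1)\}$. (ii) If $\tau\in(\frac12,\tau_1^{(2)})$, then $\beta_2\le\beta_2^{**}(\tau)$ and $\beta_1\ge\beta_1^*(\tau)>4(N+1)$. (iii) If $\tau\in(\frac12,\tau_1^{(1)})$, then $\beta_1\le\beta_1^{**}(\tau)$ and $\beta_2\ge\beta_2^*(\tau)>4$.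
   Context: A radial solution of $(P)_\tau$ with flux pair $(\beta_1,\beta_2)$ is a pair of functions $v_1,v_2\in C([0,\infty))\cap C^2((0,\infty))$ such that, for $r>0$, $$-(rv_1')'=r^{2N+1}e^{v_1}-\tau re^{v_2},\qquad -(rv_2')'=re^{v_2}-\tau r^{2N+1}e^{v_1},$$ $v_1'(0)=v_2'(0)=0$, $$\beta_1=\int_0^\infty r^{2N+1}e^{v_1}\,dr<\infty,\qquad \beta_2=\int_0^\infty re^{v_2}\,dr<\infty,$$ and $\lim_{r\to\infty}rv_1'(r)=-(\beta_1-\tau\beta_2)$, $\lim_{r\to\infty}rv_2'(r)=-(\beta_2-\tau\beta_1)$. (Equivalently, a radially symmetric distributional solution on $\mathbb{R}^2$ of $-\Delta v_1=|x|^{2N}e^{v_1}-\tau e^{v_2}$, $-\Delta v_2=e^{v_2}-\tau|x|^{2N}e^{v_1}$ with $\beta_1=\frac1{2\pi}\int|x|^{2N}e^{v_1}$, $\beta_2=\frac1{2\pi}\int e^{v_2}$ finite.) Notation: $$\beta_1^*(\tau)=4(N+1)+8\tau,\quad \beta_2^*(\tau)=4+8\tau(N+1),\quad \beta_1^{**}(\tau)=8\tau(1+2\tau(N+1)),\quad \beta_2^{**}(\tau)=8\tau(N+1+2\tau).$$ $\tau_1^{(1)}$ is the unique positive zero of $2(1-2\tau^2)(1+2\tau(N+1))-1$; $\tau_1^{(2)}$ is the unique positive zero of $2(1-2\tau^2)(N+1+2\tau)-(N+1)$ (both lie in $(\frac12,\frac1{\sqrt2})$). With $D=(N+1)^2+2\tau(N+1)+1$,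 $$\overline\beta_1=\tfrac{2}{1-\tau^2}(N+1+\tau+\sqrt D),\qquad \overline\beta_2=\tfrac{2}{1-\tau^2}(1+\tau(N+1)+\sqrt D),$$ $$\varphi_1^+(\beta_1)=2+\tau\beta_1+\sqrt{(2+\tau\beta_1)^2-\beta_1(\beta_1-4(N+1))}\ \ (0<\beta_1\le\overline\beta_1),$$ $$\varphi_2^+(\beta_2)=2(N+1)+\tau\beta_2+\sqrt{(2(N+1)+\tau\beta_2)^2-\beta_2(\beta_2-4)}\ \ (0<\beta_2\le\overline\beta_2).$$ *)

theory Defs
  imports "HOL-Analysis.Analysis"
begin

definition C2_pos :: "(real \<Rightarrow> real) \<Rightarrow> bool" where
  "C2_pos v \<longleftrightarrow>
     (\<forall>r>0. (v has_real_derivative deriv v r) (at r)) \<and>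
     (\<forall>r>0. (deriv v has_real_derivative deriv (deriv v) r) (at r)) \<and>
     continuous_on {0<..} (deriv (deriv v))"

definition radial_solution ::
  "real \<Rightarrow> real \<Rightarrow> (real \<Rightarrow> real) \<Rightarrow> (real \<Rightarrow> real) \<Rightarrow> real \<Rightarrow> real \<Rightarrow> bool" where
  "radial_solution N \<tau> v1 v2 \<beta>1 \<beta>2 \<longleftrightarrow>
     continuous_on {0..} v1 \<and> continuous_on {0..} v2 \<and>
     C2_pos v1 \<and> C2_pos v2 \<and>
     (\<forall>r>0. ((\<lambda>s. s * deriv v1 s) has_real_derivative
              - (r powr (2*N+1) * exp (v1 r) - \<tau> * r * exp (v2 r))) (at r)) \<and>
     (\<forall>r>0. ((\<lambda>s. s * deriv v2 s) has_real_derivative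
              - (r * exp (v2 r) - \<tau> * r powr (2*N+1) * exp (v1 r))) (at r)) \<and>
     (v1 has_real_derivative 0) (at 0 within {0..}) \<and>
     (v2 has_real_derivative 0) (at 0 within {0..}) \<and>
     ((\<lambda>r. r powr (2*N+1) * exp (v1 r)) has_integral \<beta>1) {0..} \<and>
     ((\<lambda>r. r * exp (v2 r)) has_integral \<beta>2) {0..} \<and>
     ((\<lambda>r. r * deriv v1 r) \<longlongrightarrow> - (\<beta>1 - \<tau> * \<beta>2)) at_top \<and>
     ((\<lambda>r. r * deriv v2 r) \<longlongrightarrow> - (\<beta>2 - \<tau> * \<beta>1)) at_top"

definition beta1_star :: "real \<Rightarrow> real \<Rightarrow> real" where
  "beta1_star N \<tau> = 4*(N+1) + 8*\<tau>"
definition beta2_star :: "real \<Rightarrow> real \<Rightarrow> real" where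
  "beta2_star N \<tau> = 4 + 8*\<tau>*(N+1)"
definition beta1_sstar :: "real \<Rightarrow> real \<Rightarrow> real" where
  "beta1_sstar N \<tau> = 8*\<tau>*(1 + 2*\<tau>*(N+1))"
definition beta2_sstar :: "real \<Rightarrow> real \<Rightarrow> real" where
  "beta2_sstar N \<tau> = 8*\<tau>*(N+1 + 2*\<tau>)"

definition tau11 :: "real \<Rightarrow> real" where
  "tau11 N = (THE t. t > 0 \<and> 2*(1 - 2*t^2)*(1 + 2*t*(N+1)) - 1 = 0)"
definition tau12 :: "real \<Rightarrow> real" where
  "tau12 N = (THE t. t > 0 \<and> 2*(1 - 2*t^2)*(N+1 + 2*t) - (N+1) = 0)"

definition Dd :: "real \<Rightarrow> real \<Rightarrow> real" where
  "Dd N \<tau> = (N+1)^2 + 2*\<tau>*(N+1) + 1"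
definition beta1_bar :: "real \<Rightarrow> real \<Rightarrow> real" where
  "beta1_bar N \<tau> = 2/(1-\<tau>^2) * (N+1+\<tau> + sqrt (Dd N \<tau>))"
definition beta2_bar :: "real \<Rightarrow> real \<Rightarrow> real" where
  "beta2_bar N \<tau> = 2/(1-\<tau>^2) * (1+\<tau>*(N+1) + sqrt (Dd N \<tau>))"

definition phi1_plus :: "real \<Rightarrow> real \<Rightarrow> real \<Rightarrow> real" where
  "phi1_plus N \<tau> b = 2 + \<tau>*b + sqrt ((2+\<tau>*b)^2 - b*(b - 4*(N+1)))"
definition phi2_plus :: "real \<Rightarrow> real \<Rightarrow> real \<Rightarrow> real" where
  "phi2_plus N \<tau> b = 2*(N+1) + \<tau>*b + sqrt ((2*(N+1)+\<tau>*b)^2 - b*(b - 4))"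

end

(*
  Write F, G for the two masses inside radius r, a = N + 1, b = 1, and let ' stand for r d/dr.
  The densities A = F' and B = G' then satisfy A' = (2a - F + tau G) A, B' = (2b - G + tau F) B,
  and the energy identity expresses A + B as a quadratic polynomial in F and G; at infinity it
  places (beta1, beta2) on the Pohozaev ellipse.
  Integrating (A (F + G))' and using the energy identity yields one more relation,
    beta1 (beta1 - 4a) ((a + b)/tau - beta1/2) = (1 - 2 tau) * int (F G + G^2/2) dF,
  which for tau = 1/2 is the cubic first integral of the Toda system. As int G dF is known in terms
  of beta1, Chebyshev's inequality for F G and Cauchy-Schwarz for G^2 bound the right-hand integral
  from below, which gives exactly beta1 <= beta1* for tau < 1/2 and beta1 >= beta1* for tau > 1/2.
  Exchanging the two components gives the same for beta2; all other bounds are read off the ellipse.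
*)
theory Submission
  imports Defs
begin

section \<open>Calculus on the positive half-line\<close>

lemma nonneg_of_deriv_nonneg:
  fixes h h' :: "real \<Rightarrow> real"
  assumes d: "\<And>s. s > 0 \<Longrightarrow> (h has_real_derivative h' s) (at s)"
    and nn: "\<And>s. s > 0 \<Longrightarrow> h' s \<ge> 0"
    and lim: "(h \<longlongrightarrow> 0) (at_right 0)" and "r > 0"
  shows "h r \<ge> 0"
proof (rule tendsto_upperbound[OF lim])
  have "h s \<le> h r" if "0 < s" "s < r" for s
  proof (rule DERIV_nonneg_imp_nondecreasing[of s r h])
    show "\<exists>y. (h has_real_derivative y) (at x) \<and> 0 \<le> y" if "s \<le> x" for x
      using d[of x] nn[of x] that \<open>0 < s\<close> by auto
  qed (use that in simp)
  then show "\<forall>\<^sub>F s in at_right 0. h s \<le> h r"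
    using \<open>r > 0\<close> by (auto simp: eventually_at_right intro!: exI[of _ r])
qed auto

text \<open>The filter \<open>L\<close> is left open so that the constant can be fixed at the origin
  (energy identity) or at infinity (flux identities).\<close>

lemma eq_0_of_deriv_0:
  fixes h :: "real \<Rightarrow> real"
  assumes d: "\<And>s. s > 0 \<Longrightarrow> (h has_real_derivative 0) (at s)"
    and lim: "(h \<longlongrightarrow> 0) L" and L: "\<forall>\<^sub>F s in L. s > 0" "L \<noteq> bot" and "r > 0"
  shows "h r = 0"
proof -
  have "\<exists>c. \<forall>s\<in>{0<..}. h s = c"
    by (rule has_field_derivative_zero_constant) (auto intro: has_field_derivative_at_within d)
  then obtain c where c: "\<And>s. s > 0 \<Longrightarrow> h s = c" by auto
  have "(h \<longlongrightarrow> c) L"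
    by (rule tendsto_eventually) (use L(1) c in \<open>auto elim!: eventually_mono\<close>)
  with lim L(2) have "c = 0" using tendsto_unique by blast
  with c \<open>r > 0\<close> show ?thesis by simp
qed

text \<open>A limit \<open>c > 0\<close> of \<open>h\<close> would force \<open>p\<close> to grow at
  least like \<open>c / 2 * ln s\<close>, contradicting its convergence.\<close>

lemma tendsto_0_of_integrable_log:
  fixes h p :: "real \<Rightarrow> real"
  assumes d: "\<And>s. s > 0 \<Longrightarrow> (p has_real_derivative h s / s) (at s)"
    and pos: "\<And>s. s > 0 \<Longrightarrow> h s \<ge> 0"
    and p: "(p \<longlongrightarrow> l) at_top" and h: "(h \<longlongrightarrow> c) at_top"
  shows "c = 0"
proof (rule ccontr)
  assume "c \<noteq> 0"
  have "c \<ge> 0"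
    by (rule tendsto_lowerbound[OF h]) (auto intro!: eventually_mono[OF eventually_gt_at_top[of 0]] pos)
  with \<open>c \<noteq> 0\<close> have "c > 0" by simp
  then have "\<forall>\<^sub>F s in at_top. h s > c / 2"
    using h by (intro order_tendstoD) auto
  then obtain R0 where R0: "\<And>s. s \<ge> R0 \<Longrightarrow> h s > c / 2"
    by (auto simp: eventually_at_top_linorder)
  define R where "R = max R0 1"
  have "p R - c / 2 * ln R \<le> p s - c / 2 * ln s" if "s \<ge> R" for s
  proof (rule DERIV_nonneg_imp_nondecreasing[OF that])
    fix x assume "R \<le> x" "x \<le> s"
    then have "x > 0" "h x > c / 2" using R0 by (auto simp: R_def)
    then show "\<exists>y. ((\<lambda>s. p s - c / 2 * ln s) has_real_derivative y) (at x) \<and> 0 \<le> y"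
      by (intro exI[of _ "h x / x - c / 2 * (1 / x)"])
        (auto intro!: derivative_eq_intros d simp: field_simps)
  qed
  then have "\<forall>\<^sub>F s in at_top. p R - c / 2 * ln R + c / 2 * ln s \<le> p s"
    by (auto simp: eventually_at_top_linorder algebra_simps)
  moreover have "filterlim (\<lambda>s. p R - c / 2 * ln R + c / 2 * ln s) at_top at_top"
    using \<open>c > 0\<close> by (intro filterlim_tendsto_add_at_top[OF tendsto_const]
      filterlim_tendsto_pos_mult_at_top[OF tendsto_const] ln_at_top) auto
  ultimately have "filterlim p at_top at_top"
    by (rule filterlim_at_top_mono[rotated])
  with p show False
    using not_tendsto_and_filterlim_at_infinity filterlim_at_top_imp_at_infinity trivial_limit_at_top_linorder by blast
qed

text \<open>Nonnegativity turns gauge integrability into absolute integrability, for which the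
  integrals over \<open>{0..r}\<close> exhaust the whole one.\<close>

lemma has_integral_atLeast_tendsto:
  fixes f :: "real \<Rightarrow> real"
  assumes int: "(f has_integral I) {0..}" and nn: "\<And>x. x \<ge> 0 \<Longrightarrow> f x \<ge> 0"
  shows "((\<lambda>r. integral {0..r} f) \<longlongrightarrow> I) at_top"
proof -
  have "f absolutely_integrable_on {0..}"
    using int nn by (intro nonnegative_absolutely_integrable_1) (auto simp: integrable_on_def)
  then have si: "set_integrable lebesgue {0..} f" .
  have "((\<lambda>r. LINT x:{0..r}|lebesgue. f x) \<longlongrightarrow> (LINT x:{0..}|lebesgue. f x)) at_top"
    by (rule tendsto_set_lebesgue_integral_at_top[OF _ si]) auto
  moreover have "(LINT x:{0..}|lebesgue. f x) = I"
    using set_lebesgue_integral_eq_integral(2)[OF si] int by (simp add: integral_unique)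
  moreover have "(LINT x:{0..r}|lebesgue. f x) = integral {0..r} f" for r
    by (rule set_lebesgue_integral_eq_integral(2)) (rule set_integrable_subset[OF si], auto)
  ultimately show ?thesis by simp
qed

section \<open>Masses, densities and the energy identity\<close>

text \<open>The radial system in Emden-Fowler form: with \<open>'\<close> standing for \<open>r d/dr\<close>, the masses
  \<open>F\<close>, \<open>G\<close> satisfy \<open>F' = A\<close>, \<open>G' = B\<close>.\<close>

locale liouville_flow =
  fixes a b \<tau> \<beta>1 \<beta>2 :: real and F G A B :: "real \<Rightarrow> real"
  assumes pos: "0 < a" "0 < b" "0 < \<tau>"
    and F [derivative_intros]: "\<And>r. r > 0 \<Longrightarrow> (F has_real_derivative A r / r) (at r)"
    and G [derivative_intros]: "\<And>r. r > 0 \<Longrightarrow> (G has_real_derivative B r / r) (at r)"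
    and A [derivative_intros]: "\<And>r. r > 0 \<Longrightarrow>
      (A has_real_derivative (2 * a - F r + \<tau> * G r) * A r / r) (at r)"
    and B [derivative_intros]: "\<And>r. r > 0 \<Longrightarrow>
      (B has_real_derivative (2 * b - G r + \<tau> * F r) * B r / r) (at r)"
    and A_pos: "\<And>r. r > 0 \<Longrightarrow> A r > 0" and B_pos: "\<And>r. r > 0 \<Longrightarrow> B r > 0"
    and lim0: "(F \<longlongrightarrow> 0) (at_right 0)" "(G \<longlongrightarrow> 0) (at_right 0)"
      "(A \<longlongrightarrow> 0) (at_right 0)" "(B \<longlongrightarrow> 0) (at_right 0)"
    and lim_F: "(F \<longlongrightarrow> \<beta>1) at_top" and lim_G: "(G \<longlongrightarrow> \<beta>2) at_top"
begin

text \<open>The system is symmetric under exchanging the components together with \<open>a\<close>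
  and \<open>b\<close>, so each result on \<open>\<beta>1\<close> also gives one on
  \<open>\<beta>2\<close>.\<close>

lemma swap: "liouville_flow b a \<tau> \<beta>2 \<beta>1 G F B A"
  by unfold_locales (use pos F G A B A_pos B_pos lim0 lim_F lim_G in auto)

text \<open>Both sides vanish at the origin and have the same derivative: because the coupling
  \<tau> is the same in both equations, the mixed terms combine to the derivative of
  \<open>\<tau> * F * G\<close>.\<close>

lemma energy:
  assumes "r > 0"
  shows "A r + B r = 2 * a * F r + 2 * b * G r - F r ^ 2 / 2 - G r ^ 2 / 2 + \<tau> * F r * G r"
proof -
  have "A r + B r - (2 * a * F r + 2 * b * G r - F r ^ 2 / 2 - G r ^ 2 / 2 + \<tau> * F r * G r) = 0"
    by (rule eq_0_of_deriv_0[where L = "at_right 0", OF _ _ _ _ assms])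
      (auto intro!: eventually_at_right_less derivative_eq_intros tendsto_eq_intros lim0 simp: field_simps power2_eq_square)
  then show ?thesis by simp
qed

lemma F_nonneg: "F r \<ge> 0" if "r > 0" for r
  by (rule nonneg_of_deriv_nonneg[OF F _ lim0(1) that]) (use A_pos in \<open>auto simp: less_imp_le\<close>)

lemma G_nonneg: "G r \<ge> 0" if "r > 0" for r
  by (rule nonneg_of_deriv_nonneg[OF G _ lim0(2) that]) (use B_pos in \<open>auto simp: less_imp_le\<close>)

lemma F_mono: "F r \<le> F s" if "0 < r" "r \<le> s" for r s
proof (rule DERIV_nonneg_imp_nondecreasing[OF that(2)])
  show "\<exists>y. (F has_real_derivative y) (at x) \<and> 0 \<le> y" if "r \<le> x" for x
    using F[of x] A_pos[of x] that \<open>0 < r\<close> by (intro exI[of _ "A x / x"]) auto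
qed

lemma \<beta>1_pos: "\<beta>1 > 0"
proof -
  have "F 1 < F 2"
  proof (rule DERIV_pos_imp_increasing[of 1 2 F])
    show "\<exists>y. (F has_real_derivative y) (at x) \<and> 0 < y" if "1 \<le> x" for x
      using F[of x] A_pos[of x] that by (intro exI[of _ "A x / x"]) auto
  qed simp
  moreover have "F 2 \<le> \<beta>1"
    by (rule tendsto_lowerbound[OF lim_F])
      (auto intro!: eventually_mono[OF eventually_ge_at_top[of 2]] F_mono)
  ultimately show ?thesis using F_nonneg[of 1] by simp
qed

lemma AB_tendsto:
  "((\<lambda>r. A r + B r) \<longlongrightarrow> 2 * a * \<beta>1 + 2 * b * \<beta>2 - \<beta>1 ^ 2 / 2 - \<beta>2 ^ 2 / 2 + \<tau> * \<beta>1 * \<beta>2) at_top"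
proof (rule Lim_transform_eventually)
  show "\<forall>\<^sub>F r in at_top. 2 * a * F r + 2 * b * G r - F r ^ 2 / 2 - G r ^ 2 / 2 + \<tau> * F r * G r = A r + B r"
    by (auto intro!: eventually_mono[OF eventually_gt_at_top[of 0]] simp: energy)
qed (auto intro!: tendsto_intros lim_F lim_G)

text \<open>By the energy identity \<open>A + B\<close> converges; being \<open>r d/dr\<close> of
  the convergent \<open>F + G\<close>, it can only converge to 0.\<close>

lemma energy_at_infinity:
  "2 * a * \<beta>1 + 2 * b * \<beta>2 - \<beta>1 ^ 2 / 2 - \<beta>2 ^ 2 / 2 + \<tau> * \<beta>1 * \<beta>2 = 0"
proof (rule tendsto_0_of_integrable_log[OF _ _ _ AB_tendsto])
  show "((\<lambda>r. F r + G r) has_real_derivative (A s + B s) / s) (at s)" if "s > 0" for s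
    using that by (auto intro!: derivative_eq_intros simp: add_divide_distrib)
  show "0 \<le> A s + B s" if "s > 0" for s
    using A_pos[OF that] B_pos[OF that] by simp
  show "((\<lambda>r. F r + G r) \<longlongrightarrow> \<beta>1 + \<beta>2) at_top"
    by (intro tendsto_intros lim_F lim_G)
qed

lemma pohozaev: "\<beta>1 ^ 2 - 2 * \<tau> * \<beta>1 * \<beta>2 + \<beta>2 ^ 2 = 4 * a * \<beta>1 + 4 * b * \<beta>2"
  using energy_at_infinity by (simp add: field_simps)

lemma A_tendsto_0: "(A \<longlongrightarrow> 0) at_top"
proof (rule tendsto_sandwich[of "\<lambda>_. 0" A at_top "\<lambda>r. A r + B r"])
  show "((\<lambda>r. A r + B r) \<longlongrightarrow> 0) at_top"
    using AB_tendsto by (simp add: energy_at_infinity)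
  show "\<forall>\<^sub>F r in at_top. 0 \<le> A r"
    by (auto intro!: eventually_mono[OF eventually_gt_at_top[of 0]] less_imp_le[OF A_pos])
  show "\<forall>\<^sub>F r in at_top. A r \<le> A r + B r"
    by (auto intro!: eventually_mono[OF eventually_gt_at_top[of 0]] less_imp_le[OF B_pos])
qed auto

section \<open>Moments of the second mass and the comparison for \<open>\<beta>1\<close>\<close>

text \<open>\<open>J = \<integral> G dF\<close>\<close>

definition J :: "real \<Rightarrow> real" where
  "J r = (A r - 2 * a * F r + F r ^ 2 / 2) / \<tau>"

text \<open>Solved for its coupling term, the equation for \<open>A\<close> reads
  \<open>\<tau> G A = A' - 2 a F' + F F'\<close>, whose right side is an exact derivative.\<close>

lemma J [derivative_intros]: "r > 0 \<Longrightarrow> (J has_real_derivative G r * (A r / r)) (at r)"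
  unfolding J_def using pos
  by (auto intro!: derivative_eq_intros simp: field_simps power2_eq_square)

lemma J_lim0: "(J \<longlongrightarrow> 0) (at_right 0)"
  unfolding J_def using pos by (auto intro!: tendsto_eq_intros lim0)

lemma J_lim: "(J \<longlongrightarrow> \<beta>1 * (\<beta>1 - 4 * a) / (2 * \<tau>)) at_top"
  unfolding J_def using pos
  by (auto intro!: tendsto_eq_intros lim_F A_tendsto_0 simp: field_simps power2_eq_square)

lemma J_mono: "J r \<le> J s" if "0 < r" "r \<le> s" for r s
proof (rule DERIV_nonneg_imp_nondecreasing[OF that(2)])
  show "\<exists>y. (J has_real_derivative y) (at x) \<and> 0 \<le> y" if "r \<le> x" for x
    using J[of x] A_pos[of x] G_nonneg[of x] that \<open>0 < r\<close>
    by (intro exI[of _ "G x * (A x / x)"]) auto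
qed

text \<open>The limit \<open>\<beta>1 * (\<beta>1 - 4 * a) / (2 * \<tau>)\<close> of
  \<open>J\<close> is strictly positive, since \<open>G > 0\<close> and \<open>F\<close>
  increases.\<close>

lemma \<beta>1_gt: "\<beta>1 > 4 * a"
proof -
  have G_pos: "G r > 0" if "r > 0" for r
  proof -
    have "G (r / 2) < G r"
    proof (rule DERIV_pos_imp_increasing[of "r / 2" r G])
      show "\<exists>y. (G has_real_derivative y) (at x) \<and> 0 < y" if "r / 2 \<le> x" for x
        using G[of x] B_pos[of x] that \<open>0 < r\<close> by (intro exI[of _ "B x / x"]) auto
    qed (use that in simp)
    then show ?thesis using G_nonneg[of "r / 2"] that by simp
  qed
  have "J 1 \<ge> 0"
    by (rule nonneg_of_deriv_nonneg[OF J _ J_lim0])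
      (use A_pos G_nonneg in \<open>auto simp: less_imp_le\<close>)
  also have "J 1 < J 2"
  proof (rule DERIV_pos_imp_increasing[of 1 2 J])
    show "\<exists>y. (J has_real_derivative y) (at x) \<and> 0 < y" if "1 \<le> x" for x
      using J[of x] A_pos[of x] G_pos[of x] that by (intro exI[of _ "G x * (A x / x)"]) auto
  qed simp
  also have "J 2 \<le> \<beta>1 * (\<beta>1 - 4 * a) / (2 * \<tau>)"
    by (rule tendsto_lowerbound[OF J_lim])
      (auto intro!: eventually_mono[OF eventually_ge_at_top[of 2]] J_mono)
  finally show ?thesis using \<beta>1_pos pos by (simp add: zero_less_divide_iff zero_less_mult_iff)
qed

text \<open>\<open>K = \<integral> (F G + G\<^sup>2/2) dF\<close>; the closed form comes from integrating \<open>(A (F + G))'\<close> and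
  eliminating \<open>A + B\<close> by the energy identity.\<close>

definition K :: "real \<Rightarrow> real" where
  "K r = ((F r + G r) * A r - 2 * a * F r ^ 2 + F r ^ 3 / 2 - 2 * (a + b) * J r) / (2 * \<tau> - 1)"

lemma K:
  assumes "\<tau> \<noteq> 1 / 2" "r > 0"
  shows "(K has_real_derivative (F r * G r + G r ^ 2 / 2) * (A r / r)) (at r)"
proof -
  have "2 * \<tau> - 1 \<noteq> 0" using assms by auto
  have "((\<lambda>r. (F r + G r) * A r - 2 * a * F r ^ 2 + F r ^ 3 / 2 - 2 * (a + b) * J r)
      has_real_derivative
      (A r + B r) * A r / r + (F r + G r) * ((2 * a - F r + \<tau> * G r) * A r / r)
       - 4 * a * F r * (A r / r) + 3 * F r ^ 2 / 2 * (A r / r) - 2 * (a + b) * (G r * (A r / r))) (at r)"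
    using assms
    by (auto intro!: derivative_eq_intros simp: field_simps power2_eq_square)
  \<comment> \<open>After \<open>A + B\<close> is replaced through the energy identity, all terms
    cancel except those in \<open>F G\<close> and \<open>G^2\<close>, and these share the factor
    \<open>2 * \<tau> - 1\<close>.\<close>
  also have "(A r + B r) * A r / r + (F r + G r) * ((2 * a - F r + \<tau> * G r) * A r / r)
       - 4 * a * F r * (A r / r) + 3 * F r ^ 2 / 2 * (A r / r) - 2 * (a + b) * (G r * (A r / r))
     = (2 * \<tau> - 1) * ((F r * G r + G r ^ 2 / 2) * (A r / r))"
    unfolding energy[OF assms(2)] using assms by (simp add: field_simps power2_eq_square)
  finally show ?thesis
    unfolding K_def using \<open>2 * \<tau> - 1 \<noteq> 0\<close> by (auto dest: DERIV_cdivide[of _ _ _ _ "2 * \<tau> - 1"])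
qed

lemma K_lim0: "\<tau> \<noteq> 1 / 2 \<Longrightarrow> (K \<longlongrightarrow> 0) (at_right 0)"
  unfolding K_def by (auto intro!: tendsto_eq_intros lim0 J_lim0)

lemma K_lim:
  assumes "\<tau> \<noteq> 1 / 2"
  shows "(K \<longlongrightarrow> (\<beta>1 ^ 3 / 2 - 2 * a * \<beta>1 ^ 2 - 2 * (a + b) * (\<beta>1 * (\<beta>1 - 4 * a) / (2 * \<tau>))) / (2 * \<tau> - 1)) at_top"
  unfolding K_def using assms
  by (auto intro!: tendsto_eq_intros lim_F lim_G A_tendsto_0 J_lim)

text \<open>The Chebyshev inequality \<open>\<integral> F G dF \<ge> F J / 2\<close> (as \<open>G\<close> increases with \<open>F\<close>) combined with
  Cauchy--Schwarz \<open>\<integral> G\<^sup>2 dF \<ge> J\<^sup>2 / F\<close>.\<close>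

lemma K_lower:
  assumes "\<tau> \<noteq> 1 / 2" "r > 0"
  shows "F r ^ 2 * J r / 2 + J r ^ 2 / 2 \<le> F r * K r"
proof -
  note K' [derivative_intros] = K[OF assms(1)]
  \<comment> \<open>By parts, \<open>F G - J\<close> is the integral of \<open>F dG\<close>.\<close>
  have 1: "0 \<le> F r * G r - J r" if "r > 0" for r
  proof (rule nonneg_of_deriv_nonneg[OF _ _ _ that])
    show "((\<lambda>r. F r * G r - J r) has_real_derivative F s * (B s / s)) (at s)" if "s > 0" for s
      using that by (auto intro!: derivative_eq_intros)
    show "0 \<le> F s * (B s / s)" if "s > 0" for s
      using that F_nonneg[of s] B_pos[of s] by simp
  qed (auto intro!: tendsto_eq_intros lim0 J_lim0)
  \<comment> \<open>This is the derivative with respect to \<open>F\<close> of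
    \<open>F K - F^2 J / 2 - J^2 / 2\<close>, the difference to be shown nonnegative.
    Differentiating once more leaves only terms controlled by the previous fact.\<close>
  have 2: "0 \<le> K r + F r ^ 2 * G r / 2 + F r * G r ^ 2 / 2 - F r * J r - J r * G r" if "r > 0" for r
  proof (rule nonneg_of_deriv_nonneg[OF _ _ _ that])
    show "((\<lambda>r. K r + F r ^ 2 * G r / 2 + F r * G r ^ 2 / 2 - F r * J r - J r * G r)
        has_real_derivative
        (F s * G s - J s) * (A s / s) + (F s ^ 2 / 2 + (F s * G s - J s)) * (B s / s)) (at s)"
      if "s > 0" for s
      using that
      by (auto intro!: derivative_eq_intros) (simp add: field_simps power2_eq_square)
    show "0 \<le> (F s * G s - J s) * (A s / s) + (F s ^ 2 / 2 + (F s * G s - J s)) * (B s / s)"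
      if "s > 0" for s
      using that 1[of s] A_pos[of s] B_pos[of s]
      by (intro add_nonneg_nonneg mult_nonneg_nonneg divide_nonneg_nonneg) auto
  qed (use assms in \<open>auto intro!: tendsto_eq_intros lim0 J_lim0 K_lim0\<close>)
  have "0 \<le> F r * K r - F r ^ 2 * J r / 2 - J r ^ 2 / 2"
  proof (rule nonneg_of_deriv_nonneg[OF _ _ _ assms(2)])
    show "((\<lambda>r. F r * K r - F r ^ 2 * J r / 2 - J r ^ 2 / 2) has_real_derivative
        (K s + F s ^ 2 * G s / 2 + F s * G s ^ 2 / 2 - F s * J s - J s * G s) * (A s / s)) (at s)"
      if "s > 0" for s
      using that
      by (auto intro!: derivative_eq_intros) (simp add: field_simps power2_eq_square)
    show "0 \<le> (K s + F s ^ 2 * G s / 2 + F s * G s ^ 2 / 2 - F s * J s - J s * G s) * (A s / s)"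
      if "s > 0" for s
      using that 2[of s] A_pos[of s] by (intro mult_nonneg_nonneg divide_nonneg_nonneg) auto
  qed (use assms in \<open>auto intro!: tendsto_eq_intros lim0 J_lim0 K_lim0\<close>)
  then show ?thesis by simp
qed

text \<open>In the limit of \<open>K_lower\<close> every term carries the positive factor
  \<open>\<beta>1 * j\<close>; dividing it out leaves an inequality linear in
  \<open>\<beta>1\<close>. Keeping the denominator \<open>2 * \<tau> - 1\<close> covers both
  regimes, its sign deciding the direction.\<close>

lemma \<beta>1_comparison:
  assumes "\<tau> \<noteq> 1 / 2"
  shows "0 \<le> (\<beta>1 - (4 * a + 8 * \<tau> * b)) / (2 * \<tau> - 1)"
proof -
  define j where "j = \<beta>1 * (\<beta>1 - 4 * a) / (2 * \<tau>)"
  define k where "k = (\<beta>1 ^ 3 / 2 - 2 * a * \<beta>1 ^ 2 - 2 * (a + b) * j) / (2 * \<tau> - 1)"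
  have "j > 0" using \<beta>1_gt \<beta>1_pos pos by (simp add: j_def)
  have nz: "2 * \<tau> - 1 \<noteq> 0" using assms by auto
  have "\<beta>1 ^ 2 * j / 2 + j ^ 2 / 2 \<le> \<beta>1 * k"
  proof (rule tendsto_le)
    show "((\<lambda>r. F r * K r) \<longlongrightarrow> \<beta>1 * k) at_top"
      unfolding k_def j_def by (intro tendsto_intros lim_F K_lim assms)
    show "((\<lambda>r. F r ^ 2 * J r / 2 + J r ^ 2 / 2) \<longlongrightarrow> \<beta>1 ^ 2 * j / 2 + j ^ 2 / 2) at_top"
      unfolding j_def by (intro tendsto_intros lim_F J_lim) auto
    show "\<forall>\<^sub>F r in at_top. F r ^ 2 * J r / 2 + J r ^ 2 / 2 \<le> F r * K r"
      by (auto intro!: eventually_mono[OF eventually_gt_at_top[of 0]] K_lower assms)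
  qed simp
  \<comment> \<open>The first two terms equal \<open>\<tau> * \<beta>1 * j\<close>.\<close>
  moreover have "\<beta>1 ^ 3 / 2 - 2 * a * \<beta>1 ^ 2 - 2 * (a + b) * j = j * (\<tau> * \<beta>1 - 2 * (a + b))"
    using pos by (simp add: j_def field_simps power2_eq_square power3_eq_cube)
  then have "k = j * (\<tau> * \<beta>1 - 2 * (a + b)) / (2 * \<tau> - 1)"
    by (simp add: k_def)
  moreover have "j ^ 2 = j * (\<beta>1 * (\<beta>1 - 4 * a) / (2 * \<tau>))"
    by (simp add: power2_eq_square) (simp add: j_def)
  ultimately have "0 \<le> (\<beta>1 * j) * ((\<tau> * \<beta>1 - 2 * (a + b)) / (2 * \<tau> - 1) - \<beta>1 / 2 - (\<beta>1 - 4 * a) / (4 * \<tau>))"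
    using nz pos by (simp add: algebra_simps power2_eq_square)
  then have "0 \<le> (\<tau> * \<beta>1 - 2 * (a + b)) / (2 * \<tau> - 1) - \<beta>1 / 2 - (\<beta>1 - 4 * a) / (4 * \<tau>)"
    using mult_pos_pos[OF \<beta>1_pos \<open>j > 0\<close>] by (smt (verit) zero_le_mult_iff)
  then have "0 \<le> 4 * \<tau> * ((\<tau> * \<beta>1 - 2 * (a + b)) / (2 * \<tau> - 1) - \<beta>1 / 2 - (\<beta>1 - 4 * a) / (4 * \<tau>))"
    using pos by (intro mult_nonneg_nonneg) auto
  also have "\<dots> = (\<beta>1 - (4 * a + 8 * \<tau> * b)) / (2 * \<tau> - 1)"
    using nz pos by (simp add: divide_simps) (simp add: algebra_simps)
  finally show ?thesis .
qed

end

section \<open>Geometry of the Pohozaev ellipse\<close>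

text \<open>The points \<open>(4a + 8\<tau>b, 4b)\<close> and \<open>(4a + 8\<tau>b, 8\<tau>(a + 2\<tau>b))\<close> lie on the ellipse, so subtracting
  its equation on the vertical line through them factorises.\<close>

lemma pohozaev_factor:
  fixes x y a b \<tau> :: real
  assumes "x ^ 2 - 2 * \<tau> * x * y + y ^ 2 = 4 * a * x + 4 * b * y"
  shows "(y - 4 * b) * (y - 8 * \<tau> * (a + 2 * \<tau> * b)) = (4 * a + 8 * \<tau> * b - x) * (x - 2 * \<tau> * (y - 4 * b))"
  using assms by (simp add: algebra_simps power2_eq_square)

text \<open>Here \<open>2 * \<tau> * (y - 4 * b) \<le> 16 * \<tau>^2 * a \<le> 4 * a < x\<close>, so
  the right side of \<open>pohozaev_factor\<close> is nonnegative. The line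
  \<open>y = 2 * b + \<tau> * x\<close> bisects vertical chords; lying above it selects the plus
  sign of the root.\<close>

lemma pohozaev_upper_arc:
  fixes x y a b \<tau> :: real
  assumes poh: "x ^ 2 - 2 * \<tau> * x * y + y ^ 2 = 4 * a * x + 4 * b * y"
    and "0 < a" "0 < \<tau>" "\<tau> < 1 / 2" "x > 4 * a" "y > 4 * b"
    and x: "x \<le> 4 * a + 8 * \<tau> * b" and y: "y \<le> 4 * b + 8 * \<tau> * a"
  shows "y \<ge> 8 * \<tau> * (a + 2 * \<tau> * b)" and "y \<ge> 2 * b + \<tau> * x"
proof -
  have "2 * \<tau> * (y - 4 * b) \<le> 2 * \<tau> * (8 * \<tau> * a)"
    using y \<open>0 < \<tau>\<close> by (intro mult_left_mono) auto
  also have "\<dots> = (4 * \<tau> ^ 2) * (4 * a)" by (simp add: power2_eq_square)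
  also have "\<dots> \<le> 1 * (4 * a)"
    using power_mono[of \<tau> "1 / 2" 2] assms by (intro mult_right_mono) (auto simp: power_divide)
  finally have "0 \<le> (4 * a + 8 * \<tau> * b - x) * (x - 2 * \<tau> * (y - 4 * b))"
    using x \<open>x > 4 * a\<close> by (intro mult_nonneg_nonneg) auto
  then show *: "y \<ge> 8 * \<tau> * (a + 2 * \<tau> * b)"
    unfolding pohozaev_factor[OF poh, symmetric] using \<open>y > 4 * b\<close> by (simp add: zero_le_mult_iff)
  have "\<tau> * x \<le> \<tau> * (4 * a + 8 * \<tau> * b)"
    using x \<open>0 < \<tau>\<close> by (intro mult_left_mono) auto
  also have "\<dots> = 8 * \<tau> * (a + 2 * \<tau> * b) / 2" by (simp add: algebra_simps)
  finally show "y \<ge> 2 * b + \<tau> * x" using * \<open>y > 4 * b\<close> by linarith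
qed

lemma pohozaev_root:
  fixes x y a b \<tau> :: real
  assumes poh: "x ^ 2 - 2 * \<tau> * x * y + y ^ 2 = 4 * a * x + 4 * b * y" and "y \<ge> 2 * b + \<tau> * x"
  shows "y = 2 * b + \<tau> * x + sqrt ((2 * b + \<tau> * x) ^ 2 - x * (x - 4 * a))"
proof -
  have "(2 * b + \<tau> * x) ^ 2 - x * (x - 4 * a) = (y - (2 * b + \<tau> * x)) ^ 2"
    using poh by (simp add: algebra_simps power2_eq_square)
  then show ?thesis using assms(2) by simp
qed

text \<open>The equation, as a quadratic in \<open>y\<close>, has a real root, so its discriminant
  is nonnegative; the bound is the abscissa of the rightmost point of the ellipse.\<close>

lemma pohozaev_extent:
  fixes x y a b \<tau> :: real
  assumes poh: "x ^ 2 - 2 * \<tau> * x * y + y ^ 2 = 4 * a * x + 4 * b * y" and "0 < \<tau>" "\<tau> < 1"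
  shows "x \<le> 2 / (1 - \<tau> ^ 2) * (a + \<tau> * b + sqrt (a ^ 2 + 2 * \<tau> * a * b + b ^ 2))"
proof -
  have c: "1 - \<tau> ^ 2 > 0" using assms by (simp add: power_less_one_iff abs_square_less_1)
  have "0 \<le> (1 - \<tau> ^ 2) * (y - (2 * b + \<tau> * x)) ^ 2" using c by simp
  also have "(y - (2 * b + \<tau> * x)) ^ 2 = (2 * b + \<tau> * x) ^ 2 - x * (x - 4 * a)"
    using poh by (simp add: algebra_simps power2_eq_square)
  also have "(1 - \<tau> ^ 2) * ((2 * b + \<tau> * x) ^ 2 - x * (x - 4 * a))
      = 4 * (a ^ 2 + 2 * \<tau> * a * b + b ^ 2) - ((1 - \<tau> ^ 2) * x - 2 * (a + \<tau> * b)) ^ 2"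
    by (simp add: algebra_simps power2_eq_square)
  finally have "(((1 - \<tau> ^ 2) * x - 2 * (a + \<tau> * b)) / 2) ^ 2 \<le> a ^ 2 + 2 * \<tau> * a * b + b ^ 2"
    by (simp add: power_divide)
  then have "((1 - \<tau> ^ 2) * x - 2 * (a + \<tau> * b)) / 2 \<le> sqrt (a ^ 2 + 2 * \<tau> * a * b + b ^ 2)"
    by (rule real_le_rsqrt)
  then show ?thesis using c by (simp add: field_simps)
qed

text \<open>Otherwise the factorisation puts \<open>(x, y)\<close> above the line
  \<open>x = 2 * \<tau> * (y - 4 * b)\<close>. By \<open>cond\<close>, the point of that line with
  abscissa \<open>x\<close> is already outside the ellipse and above the chord midpoint, so no point
  of the ellipse lies higher.\<close>

lemma pohozaev_past_fourth_reflection: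
  fixes x y a b \<tau> :: real
  assumes poh: "x ^ 2 - 2 * \<tau> * x * y + y ^ 2 = 4 * a * x + 4 * b * y"
    and "0 < a" "0 < b" "1 / 2 < \<tau>" "y > 4 * b"
    and x: "x \<ge> 4 * a + 8 * \<tau> * b"
    and cond: "a * (1 - 4 * \<tau> ^ 2) + 4 * \<tau> * b * (1 - 2 * \<tau> ^ 2) > 0"
  shows "y \<le> 8 * \<tau> * (a + 2 * \<tau> * b)"
proof (rule ccontr)
  assume "\<not> ?thesis"
  then have "0 < (y - 4 * b) * (y - 8 * \<tau> * (a + 2 * \<tau> * b))"
    using \<open>y > 4 * b\<close> by simp
  then have "x < 2 * \<tau> * (y - 4 * b)"
    unfolding pohozaev_factor[OF poh] using x by (simp add: zero_less_mult_iff)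
  define z where "z = 4 * b + x / (2 * \<tau>)"
  have "\<tau> > 0" using assms by simp
  have "0 < 4 * a + 8 * \<tau> * b" using \<open>0 < a\<close> \<open>0 < b\<close> \<open>\<tau> > 0\<close> by (simp add: add_pos_pos)
  with x have "x > 0" by linarith
  \<comment> \<open>As \<open>\<tau> > 1 / 2\<close>, the first summand of \<open>cond\<close> is
    negative; so the second is positive, which forces \<open>2 * \<tau>^2 < 1\<close>.\<close>
  have "1 - 4 * \<tau> ^ 2 < 0"
    using power_strict_mono[of "1 / 2" \<tau> 2] assms by (simp add: power_divide)
  then have "a * (1 - 4 * \<tau> ^ 2) < 0" using \<open>0 < a\<close> by (rule mult_pos_neg[rotated])
  with cond have "0 < 4 * \<tau> * b * (1 - 2 * \<tau> ^ 2)" by linarith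
  then have "0 < 1 - 2 * \<tau> ^ 2" by (rule zero_less_mult_pos) (use \<open>\<tau> > 0\<close> \<open>0 < b\<close> in simp)
  then have "0 < x * (1 - 2 * \<tau> ^ 2) / \<tau>" using \<open>x > 0\<close> \<open>\<tau> > 0\<close> by simp
  also have "\<dots> = x / \<tau> - 2 * \<tau> * x" using \<open>\<tau> > 0\<close> by (simp add: field_simps power2_eq_square)
  finally have steep: "0 < x / \<tau> - 2 * \<tau> * x" .
  have "z < y" using \<open>x < 2 * \<tau> * (y - 4 * b)\<close> \<open>\<tau> > 0\<close> by (simp add: z_def field_simps)
  moreover have "0 < y + z - 2 * \<tau> * x - 4 * b"
    using \<open>z < y\<close> steep \<open>0 < b\<close> by (simp add: z_def)
  ultimately have "0 < (y - z) * (y + z - 2 * \<tau> * x - 4 * b)" by simp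
  also have "\<dots> = - (x ^ 2 - 2 * \<tau> * x * z + z ^ 2 - 4 * a * x - 4 * b * z)"
    using poh by (simp add: algebra_simps power2_eq_square)
  also have "\<dots> = - (x * ((x - (4 * a + 8 * \<tau> * b)) / (4 * \<tau> ^ 2)
      + (a * (1 - 4 * \<tau> ^ 2) + 4 * \<tau> * b * (1 - 2 * \<tau> ^ 2)) / \<tau> ^ 2))"
    using \<open>\<tau> > 0\<close> by (simp add: z_def field_simps power2_eq_square)
  also have "\<dots> \<le> 0"
    using x cond \<open>x > 0\<close> by simp
  finally show False by simp
qed

text \<open>The quotient \<open>h t / t\<close> strictly decreases for \<open>t > 0\<close>, so
  \<open>h\<close> has at most one positive zero and is positive before it; existence follows from
  \<open>h 0 > 0 > h 1\<close>. Here \<open>A\<close> and \<open>B\<close> are constants, in the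
  role of \<open>a\<close> and \<open>b\<close>.\<close>

lemma below_unique_zero:
  fixes A B \<tau> :: real
  assumes "A > 0" "B > 0" "0 < \<tau>"
    and less: "\<tau> < (THE t. t > 0 \<and> 2 * (1 - 2 * t ^ 2) * (A + 2 * t * B) - A = 0)"
  shows "A * (1 - 4 * \<tau> ^ 2) + 4 * \<tau> * B * (1 - 2 * \<tau> ^ 2) > 0"
proof -
  define h where "h t = 2 * (1 - 2 * t ^ 2) * (A + 2 * t * B) - A" for t
  have h_less: "s * h t < t * h s" if "0 < s" "s < t" for s t
  proof -
    have "t * h s - s * h t = (t - s) * (A + 4 * A * (s * t) + 8 * B * (s * t) * (s + t))"
      by (simp add: h_def algebra_simps power2_eq_square)
    also have "\<dots> > 0"
      using that assms by (intro mult_pos_pos add_pos_pos) auto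
    finally show ?thesis by simp
  qed
  have "\<exists>t\<ge>0. t \<le> 1 \<and> h t = 0"
    unfolding h_def using assms by (intro IVT2) (auto intro!: continuous_intros)
  then obtain T where "T \<ge> 0" "h T = 0" by auto
  moreover have "h 0 \<noteq> 0" using assms by (simp add: h_def)
  ultimately have T: "T > 0" "h T = 0" by (auto simp: less_le)
  have "(THE t. t > 0 \<and> h t = 0) = T"
  proof (rule the_equality)
    show "t = T" if "t > 0 \<and> h t = 0" for t
      using that T h_less[of t T] h_less[of T t] by (cases t T rule: linorder_cases) auto
  qed (use T in simp)
  with less have "\<tau> < T" by (simp add: h_def)
  with h_less[of \<tau> T] T \<open>0 < \<tau>\<close> have "h \<tau> > 0" by (simp add: zero_less_mult_iff)
  then show ?thesis by (simp add: h_def algebra_simps power2_eq_square)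
qed

section \<open>From radial solutions to the flow\<close>

lemma radial_solution_flow:
  assumes "N > 0" "0 < \<tau>" and sol: "radial_solution N \<tau> v1 v2 \<beta>1 \<beta>2"
  shows "\<exists>F G A B. liouville_flow (N + 1) 1 \<tau> \<beta>1 \<beta>2 F G A B"
proof -
  define f where "f r = r powr (2 * N + 1) * exp (v1 r)" for r
  define g where "g r = r * exp (v2 r)" for r
  define F where "F r = integral {0..r} f" for r
  define G where "G r = integral {0..r} g" for r
  note sol = sol[unfolded radial_solution_def C2_pos_def]
  have cont_f: "continuous_on {0..} f" and cont_g: "continuous_on {0..} g"
    unfolding f_def g_def using sol \<open>N > 0\<close>
    by (auto intro!: continuous_intros continuous_on_powr')
  have primitive: "((\<lambda>r. integral {0..r} k) has_real_derivative k r) (at r)"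
    and primitive_0: "((\<lambda>r. integral {0..r} k) \<longlongrightarrow> 0) (at_right 0)"
    if k: "continuous_on {0..} k" and "r > 0" for k :: "real \<Rightarrow> real" and r
  proof -
    \<comment> \<open>The interval reaches beyond \<open>r\<close> to make \<open>r\<close> an
      interior point.\<close>
    have "((\<lambda>r. integral {0..r} k) has_real_derivative k r) (at r within {0..r + 1})"
      by (rule integral_has_real_derivative)
        (use that in \<open>auto intro: continuous_on_subset[OF k]\<close>)
    moreover have "at r within {0..r + 1} = at r"
      using \<open>r > 0\<close> by (intro at_within_interior) simp
    ultimately show "((\<lambda>r. integral {0..r} k) has_real_derivative k r) (at r)" by simp
    have "continuous_on {0..1} (\<lambda>r. integral {0..r} k)"
      by (intro indefinite_integral_continuous_1 integrable_continuous_interval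
          continuous_on_subset[OF k]) auto
    then have "((\<lambda>r. integral {0..r} k) \<longlongrightarrow> integral {0..0} k) (at 0 within {0..1})"
      unfolding continuous_on_def by (rule bspec) simp
    then show "((\<lambda>r. integral {0..r} k) \<longlongrightarrow> 0) (at_right 0)"
      by (simp add: at_within_Icc_at_right)
  qed
  note F' [derivative_intros] = primitive[OF cont_f, folded F_def]
  note G' [derivative_intros] = primitive[OF cont_g, folded G_def]
  have F_lim: "(F \<longlongrightarrow> \<beta>1) at_top" and G_lim: "(G \<longlongrightarrow> \<beta>2) at_top"
  proof -
    have "(f has_integral \<beta>1) {0..}" "(g has_integral \<beta>2) {0..}"
      using sol unfolding f_def [abs_def] g_def [abs_def] by blast+
    then show "(F \<longlongrightarrow> \<beta>1) at_top" "(G \<longlongrightarrow> \<beta>2) at_top"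
      unfolding F_def G_def by (auto intro!: has_integral_atLeast_tendsto simp: f_def g_def)
  qed
  \<comment> \<open>The constant of integration is determined at infinity, where the prescribed
    limit of \<open>r * deriv v1 r\<close> cancels those of the masses.\<close>
  have flux1: "r * deriv v1 r = - F r + \<tau> * G r" if "r > 0" for r
  proof -
    have "r * deriv v1 r + F r - \<tau> * G r = 0"
    proof (rule eq_0_of_deriv_0[where L = at_top, OF _ _ _ _ that])
      have "((\<lambda>s. s * deriv v1 s + F s - \<tau> * G s) \<longlongrightarrow> - (\<beta>1 - \<tau> * \<beta>2) + \<beta>1 - \<tau> * \<beta>2) at_top"
        using sol by (intro tendsto_intros F_lim G_lim) auto
      then show "((\<lambda>s. s * deriv v1 s + F s - \<tau> * G s) \<longlongrightarrow> 0) at_top" by simp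
      show "((\<lambda>s. s * deriv v1 s + F s - \<tau> * G s) has_real_derivative 0) (at s)" if "s > 0" for s
      proof -
        have "((\<lambda>s. s * deriv v1 s) has_real_derivative - (f s - \<tau> * g s)) (at s)"
          using sol that by (auto simp: f_def g_def mult.assoc)
        then have "((\<lambda>s. s * deriv v1 s + F s - \<tau> * G s) has_real_derivative
            - (f s - \<tau> * g s) + f s - \<tau> * g s) (at s)"
          using that by (intro derivative_intros DERIV_cmult)
        then show ?thesis by simp
      qed
    qed (auto intro: eventually_gt_at_top)
    then show ?thesis by simp
  qed
  have flux2: "r * deriv v2 r = - G r + \<tau> * F r" if "r > 0" for r
  proof -
    have "r * deriv v2 r + G r - \<tau> * F r = 0"
    proof (rule eq_0_of_deriv_0[where L = at_top, OF _ _ _ _ that])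
      have "((\<lambda>s. s * deriv v2 s + G s - \<tau> * F s) \<longlongrightarrow> - (\<beta>2 - \<tau> * \<beta>1) + \<beta>2 - \<tau> * \<beta>1) at_top"
        using sol by (intro tendsto_intros F_lim G_lim) auto
      then show "((\<lambda>s. s * deriv v2 s + G s - \<tau> * F s) \<longlongrightarrow> 0) at_top" by simp
      show "((\<lambda>s. s * deriv v2 s + G s - \<tau> * F s) has_real_derivative 0) (at s)" if "s > 0" for s
      proof -
        have "((\<lambda>s. s * deriv v2 s) has_real_derivative - (g s - \<tau> * f s)) (at s)"
          using sol that by (auto simp: f_def g_def mult.assoc)
        then have "((\<lambda>s. s * deriv v2 s + G s - \<tau> * F s) has_real_derivative
            - (g s - \<tau> * f s) + g s - \<tau> * f s) (at s)"
          using that by (intro derivative_intros DERIV_cmult)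
        then show ?thesis by simp
      qed
    qed (auto intro: eventually_gt_at_top)
    then show ?thesis by simp
  qed
  have times_r_0: "((\<lambda>r. r * k r) \<longlongrightarrow> 0) (at_right 0)" if k: "continuous_on {0..} k" for k :: "real \<Rightarrow> real"
  proof -
    have "((\<lambda>r. r * k r) \<longlongrightarrow> 0 * k 0) (at 0 within {0..})"
      using k by (intro tendsto_intros) (auto simp: continuous_on_def)
    then show ?thesis by (auto intro: tendsto_within_subset)
  qed
  have "liouville_flow (N + 1) 1 \<tau> \<beta>1 \<beta>2 F G (\<lambda>r. r * f r) (\<lambda>r. r * g r)"
  proof
    show "((\<lambda>r. r * f r) has_real_derivative (2 * (N + 1) - F r + \<tau> * G r) * (r * f r) / r) (at r)"
      if "r > 0" for r
    proof -
      have "(v1 has_real_derivative deriv v1 r) (at r)" using sol that by auto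
      then have "((\<lambda>r. exp (v1 r)) has_real_derivative exp (v1 r) * deriv v1 r) (at r)"
        by (auto intro!: derivative_eq_intros)
      from DERIV_mult[OF has_real_derivative_powr[OF that] this]
      have "(f has_real_derivative (2 * N + 1) * r powr (2 * N + 1 - 1) * exp (v1 r)
          + exp (v1 r) * deriv v1 r * r powr (2 * N + 1)) (at r)"
        unfolding f_def .
      also have "r powr (2 * N + 1 - 1) = r powr (2 * N + 1) / r"
        using that by (simp only: powr_diff) simp
      also have "(2 * N + 1) * (r powr (2 * N + 1) / r) * exp (v1 r)
          + exp (v1 r) * deriv v1 r * r powr (2 * N + 1) = f r * ((2 * N + 1) / r + deriv v1 r)"
        using that by (simp add: f_def field_simps)
      finally have "(f has_real_derivative f r * ((2 * N + 1) / r + deriv v1 r)) (at r)" .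
      then have "((\<lambda>r. r * f r) has_real_derivative
          f r + r * (f r * ((2 * N + 1) / r + deriv v1 r))) (at r)"
        by (auto intro!: derivative_eq_intros)
      \<comment> \<open>The extra factor \<open>r\<close> in the density raises
        \<open>2 * N + 1\<close> to \<open>2 * (N + 1)\<close>, which is
        \<open>2 * a\<close>.\<close>
      also have "f r + r * (f r * ((2 * N + 1) / r + deriv v1 r)) = (2 * (N + 1) + r * deriv v1 r) * f r"
        using that by (simp add: field_simps)
      also have "\<dots> = (2 * (N + 1) - F r + \<tau> * G r) * (r * f r) / r"
        using that by (simp add: flux1)
      finally show ?thesis .
    qed
    show "((\<lambda>r. r * g r) has_real_derivative (2 * 1 - G r + \<tau> * F r) * (r * g r) / r) (at r)"
      if "r > 0" for r
    proof -
      have "(v2 has_real_derivative deriv v2 r) (at r)" using sol that by auto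
      then have "((\<lambda>r. r * g r) has_real_derivative (2 + r * deriv v2 r) * g r) (at r)"
        unfolding g_def by (auto intro!: derivative_eq_intros simp: field_simps)
      also have "(2 + r * deriv v2 r) * g r = (2 * 1 - G r + \<tau> * F r) * (r * g r) / r"
        using that by (simp add: flux2)
      finally show ?thesis .
    qed
    show "(F has_real_derivative r * f r / r) (at r)" "(G has_real_derivative r * g r / r) (at r)"
      if "r > 0" for r
      using F'[OF that] G'[OF that] that by auto
    show "(F \<longlongrightarrow> 0) (at_right 0)" "(G \<longlongrightarrow> 0) (at_right 0)"
      unfolding F_def G_def using primitive_0[OF cont_f zero_less_one] primitive_0[OF cont_g zero_less_one] .
    show "((\<lambda>r. r * f r) \<longlongrightarrow> 0) (at_right 0)" "((\<lambda>r. r * g r) \<longlongrightarrow> 0) (at_right 0)"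
      by (rule times_r_0, fact)+
  qed (use assms in \<open>auto simp: f_def g_def intro!: F_lim G_lim\<close>)
  then show ?thesis by blast
qed

section \<open>Flux bounds in the three ranges of \<tau>\<close>

theorem mainTheorem6:
  fixes N \<tau> \<beta>1 \<beta>2 :: real and v1 v2 :: "real \<Rightarrow> real"
  assumes "N > 0" and "0 < \<tau>" and "\<tau> < 1"
    and "radial_solution N \<tau> v1 v2 \<beta>1 \<beta>2"
  shows
   "(\<tau> < 1/2 \<longrightarrow>
       \<beta>1 \<le> beta1_star N \<tau> \<and> \<beta>2 \<le> beta2_star N \<tau> \<and>
       (0 < \<beta>1 \<and> \<beta>1 \<le> beta1_bar N \<tau> \<and> \<beta>2 = phi1_plus N \<tau> \<beta>1 \<and>
        \<beta>2 \<ge> max (beta2_sstar N \<tau>) 4) \<and>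
       (0 < \<beta>2 \<and> \<beta>2 \<le> beta2_bar N \<tau> \<and> \<beta>1 = phi2_plus N \<tau> \<beta>2 \<and>
        \<beta>1 \<ge> max (beta1_sstar N \<tau>) (4*(N+1)))) \<and>
    (1/2 < \<tau> \<and> \<tau> < tau12 N \<longrightarrow>
       \<beta>2 \<le> beta2_sstar N \<tau> \<and> \<beta>1 \<ge> beta1_star N \<tau> \<and> beta1_star N \<tau> > 4*(N+1)) \<and>
    (1/2 < \<tau> \<and> \<tau> < tau11 N \<longrightarrow>
       \<beta>1 \<le> beta1_sstar N \<tau> \<and> \<beta>2 \<ge> beta2_star N \<tau> \<and> beta2_star N \<tau> > 4)"
proof -
  obtain F G A B where "liouville_flow (N + 1) 1 \<tau> \<beta>1 \<beta>2 F G A B"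
    using radial_solution_flow[OF assms(1,2,4)] by blast
  then interpret P: liouville_flow "N + 1" 1 \<tau> \<beta>1 \<beta>2 F G A B .
  interpret Q: liouville_flow 1 "N + 1" \<tau> \<beta>2 \<beta>1 G F B A
    by (rule P.swap)
  have D: "(N + 1) ^ 2 + 2 * \<tau> * (N + 1) * 1 + 1 ^ 2 = Dd N \<tau>"
    "1 ^ 2 + 2 * \<tau> * 1 * (N + 1) + (N + 1) ^ 2 = Dd N \<tau>"
    by (simp_all add: Dd_def)
  have "\<beta>1 \<le> beta1_bar N \<tau>" "\<beta>2 \<le> beta2_bar N \<tau>"
    using pohozaev_extent[OF P.pohozaev assms(2,3)] pohozaev_extent[OF Q.pohozaev assms(2,3)]
    unfolding D by (simp_all add: beta1_bar_def beta2_bar_def)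
  note bar = this and gt = P.\<beta>1_gt Q.\<beta>1_gt
  note star_defs = beta1_star_def beta2_star_def beta1_sstar_def beta2_sstar_def
  have 1: ?thesis if "\<tau> < 1 / 2"
  proof -
    have le: "\<beta>1 \<le> 4 * (N + 1) + 8 * \<tau> * 1" "\<beta>2 \<le> 4 * 1 + 8 * \<tau> * (N + 1)"
      using P.\<beta>1_comparison Q.\<beta>1_comparison that by (auto simp: zero_le_divide_iff)
    note arc1 = pohozaev_upper_arc[OF P.pohozaev P.pos(1) assms(2) that gt le]
    note arc2 = pohozaev_upper_arc[OF Q.pohozaev Q.pos(1) assms(2) that gt(2,1) le(2,1)]
    have "\<beta>2 = phi1_plus N \<tau> \<beta>1" "\<beta>1 = phi2_plus N \<tau> \<beta>2"
      using pohozaev_root[OF P.pohozaev arc1(2)] pohozaev_root[OF Q.pohozaev arc2(2)]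
      unfolding phi1_plus_def phi2_plus_def mult_1_right .
    moreover have "max (beta2_sstar N \<tau>) 4 \<le> \<beta>2" "max (beta1_sstar N \<tau>) (4 * (N + 1)) \<le> \<beta>1"
      using gt arc1(1) arc2(1) by (simp_all add: star_defs)
    moreover have "\<beta>1 \<le> beta1_star N \<tau>" "\<beta>2 \<le> beta2_star N \<tau>"
      using le by (simp_all add: star_defs)
    moreover have "\<not> 1 / 2 < \<tau>" using that by simp
    ultimately show ?thesis using bar P.\<beta>1_pos Q.\<beta>1_pos
      by (intro conjI impI) (assumption | (elim conjE, erule (1) notE))+
  qed
  have ge: "\<beta>1 \<ge> 4 * (N + 1) + 8 * \<tau> * 1" "\<beta>2 \<ge> 4 * 1 + 8 * \<tau> * (N + 1)" if "1 / 2 < \<tau>"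
    using P.\<beta>1_comparison Q.\<beta>1_comparison that by (auto simp: zero_le_divide_iff)
  \<comment> \<open>With \<open>a = N + 1\<close> and \<open>b = 1\<close>, the polynomial defining
    \<open>tau12\<close> is the left side of \<open>cond\<close>; exchanging \<open>a\<close> and
    \<open>b\<close> gives that of \<open>tau11\<close>.\<close>
  have 2: "\<beta>2 \<le> beta2_sstar N \<tau>" if "1 / 2 < \<tau>" "\<tau> < tau12 N"
    using pohozaev_past_fourth_reflection[OF P.pohozaev P.pos(1,2) that(1) gt(2) ge(1)[OF that(1)]]
      below_unique_zero[OF P.pos(1,2) assms(2)] that(2)
    by (simp add: tau12_def star_defs)
  have 3: "\<beta>1 \<le> beta1_sstar N \<tau>" if "1 / 2 < \<tau>" "\<tau> < tau11 N"
    using pohozaev_past_fourth_reflection[OF Q.pohozaev Q.pos(1,2) that(1) gt(1) ge(2)[OF that(1)]]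
      below_unique_zero[OF Q.pos(1,2) assms(2)] that(2)
    by (simp add: tau11_def star_defs)
  have "8 * \<tau> > 0" "8 * \<tau> * (N + 1) > 0" using assms by simp_all
  then have "beta1_star N \<tau> > 4 * (N + 1)" "beta2_star N \<tau> > 4"
    by (simp_all add: star_defs)
  moreover have "\<beta>1 \<ge> beta1_star N \<tau>" "\<beta>2 \<ge> beta2_star N \<tau>" if "1 / 2 < \<tau>"
    using ge[OF that] by (simp_all add: star_defs)
  ultimately show ?thesis
    using 1 2 3 by blast
qed

end
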